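(* Let $n\ge k>0$ be integers, let $\lambda,\mu,\nu$ be binary sequences of length $n$ with exactly $k$ ones, let $P^{\nu,\overline\Omega}_{\lambda\mu}$ be a refined puzzle of a puzzle $P^{\nu,\Omega}_{\lambda\mu}$ (with respect to an atomic refinement $\overline\Omega$ of $\Omega$), and let $I^{\nu,\overline\Omega}_{\lambda\mu}\subseteq\mathbb{F}_3[x_1,\dots,x_N]$, $N=\frac{3n(n+1)}2$, be the atomic puzzle ideal of $P^{\nu,\overline\Omega}_{\lambda\mu}$. Then there is a one-one correspondence (bijection) between the $\mathbb{F}_3$-variety $V(I^{\nu,\overline\Omega}_{\lambda\mu})\subseteq\mathbb{F}_3^N$ and the set $S(P^{\nu,\overline\Omega}_{\lambda\mu})$ of tilings of $\bigtriangleup^\nu_{\lambda\mu}$ with $\overline\Omega$.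
   Context: **Puzzles.** $\bigtriangleup^{\nu}_{\lambda\mu}$ is the upward equilateral triangle of side length $n$, subdivided into $n^2$ unit triangles with $N=\frac{3n(n+1)}{2}$ unit intervals as sides; the unit intervals of its left, right and bottom sides carry the values of $\lambda,\mu,\nu$ respectively, each side read from left to right. An $\mathbb{F}_q$-valued puzzle piece is a convex polygon whose sides are parallel to sides of the big triangle and of integer length, with an $\mathbb{F}_q$-value on each unit interval of its boundary. A tiling of a piece $p$ (possibly $\bigtriangleup^\nu_{\lambda\mu}$) with a set of pieces is a covering of $p$ by translates of pieces of the set (repetition allowed; no rotation or mirroring) without overlaps or gaps, such that values on common edges of adjacent pieces match and values on the boundary of $p$ match. $\mathbb{F}_2$-values are embedded in $\mathbb{F}_3$ as $0,1$. A puzzle $P^{\nu,\Omega}_{\lambda\mu}$ consists of $\bigtriangleup^\nu_{\lambda\mu}$ and a set $\Omega$ of $\mathbb{F}_2$-valued pieces. **Atomic refinement.** An atomic piece is an $\mathbb{F}_3$-valued unit triangle whose three values sum to $0$ in $\mathbb{F}_3$. $\Omega$ is refinable if each $p\in\Omega$ has a tiling $\overline t_p$ with atomic pieces; this is assumed throughout. Given a choice of such tilings, the atomic refinement $\overline\Omega$ of $\Omega$ induced by $\{\overline t_p\}$ is the set of all atomic pieces appearing in the tilings $\overline t_p$, $p\in\Omega$. The refined puzzle $P^{\nu,\overline\Omega}_{\lambda\mu}$ consists of $\bigtriangleup^\nu_{\lambda\mu}$ and $\overline\Omega$; $S(P^{\nu,\overline\Omega}_{\lambda\mu})$ is the set of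 tilings of $\bigtriangleup^\nu_{\lambda\mu}$ with $\overline\Omega$. **Distinguishing polynomials.** An upward (downward) atomic piece is identified with the vector of values of its left, right, bottom (left, top, right) sides. An upward (downward) distinguishing polynomial w.r.t. $\overline\Omega$ is $f\in\mathbb{F}_3[x,y,z]/\langle x^3-x,y^3-y,z^3-z\rangle$ such that for each upward (downward) atomic piece $a$: $f(a)=0$ iff $a\in\overline\Omega$. **Atomic puzzle ideal.** Introduce variables $x_1,\dots,x_N$, one per unit interval, and fix an upward and a downward distinguishing polynomial w.r.t. $\overline\Omega$. Set: $\mathcal F_1=\{x_i^3-x_i: 1\le i\le N\}$; $\mathcal F_2=\{x_{lj}-\lambda_j,\ x_{rj}-\mu_j,\ x_{bj}-\nu_j: 1\le j\le n\}$, where $x_{lj},x_{rj},x_{bj}$ are the variables of the $j$-th intervals (left to right) of the left, right, bottom sides; $\mathcal F_3$ = for each unit triangle, the sum of its three side variables; $\mathcal F_4$ = for each upward unit triangle, the upward distinguishing polynomial evaluated at its left, right, bottom variables, and for each downward unit triangle, the downward one evaluated at its left, top, right variables. The atomic puzzle ideal is the ideal of $\mathbb{F}_3[x_1,\dots,x_N]$ generated by $\mathcal F_1\cup\mathcal F_2\cup\mathcal F_3\cup\mathcal F_4$. $V(\cdot)$ is the set of common zeros in $\mathbb{F}_3^N$. *)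

theory Defs
  imports
    "HOL-Analysis.Analysis"
    "HOL-Algebra.QuotRing"
    "HOL-Library.Poly_Mapping"
    "HOL-Library.Numeral_Type"
begin

section \<open>The triangular lattice\<close>

text \<open>
  The pair of integers (a, b) stands for the point a + b * cis (pi / 3) of the plane.
  \<open>Slash a b\<close>, \<open>Backslash a b\<close> and \<open>Horiz a b\<close> are the left, right and bottom side of the
  upward unit triangle \<open>Up a b\<close>, whose corners are (a, b), (a + 1, b) and (a, b + 1).
  \<open>Down a b\<close> is the downward unit triangle on the other side of \<open>Backslash a b\<close>.
\<close>

datatype edge = Slash int int | Backslash int int | Horiz int int

datatype cell = Up int int | Down int int

text \<open>Listed as left, right, bottom (upward) and as left, top, right (downward).\<close>

fun sides :: "cell \<Rightarrow> edge list" where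
  "sides (Up a b) = [Slash a b, Backslash a b, Horiz a b]"
| "sides (Down a b) = [Backslash a b, Horiz a (b + 1), Slash (a + 1) b]"

definition lattice_point :: "int \<Rightarrow> int \<Rightarrow> complex" where
  "lattice_point a b = of_int a + of_int b * cis (pi / 3)"

fun cell_hull :: "cell \<Rightarrow> complex set" where
  "cell_hull (Up a b) =
     convex hull {lattice_point a b, lattice_point (a + 1) b, lattice_point a (b + 1)}"
| "cell_hull (Down a b) =
     convex hull {lattice_point (a + 1) b, lattice_point a (b + 1), lattice_point (a + 1) (b + 1)}"

definition region :: "cell set \<Rightarrow> complex set" where
  "region C = (\<Union>c\<in>C. cell_hull c)"

definition boundary :: "cell set \<Rightarrow> edge set" where
  "boundary C = {e. \<exists>!c. c \<in> C \<and> e \<in> set (sides c)}"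

fun shift_edge :: "int \<times> int \<Rightarrow> edge \<Rightarrow> edge" where
  "shift_edge (u, v) (Slash a b) = Slash (a + u) (b + v)"
| "shift_edge (u, v) (Backslash a b) = Backslash (a + u) (b + v)"
| "shift_edge (u, v) (Horiz a b) = Horiz (a + u) (b + v)"

fun shift_cell :: "int \<times> int \<Rightarrow> cell \<Rightarrow> cell" where
  "shift_cell (u, v) (Up a b) = Up (a + u) (b + v)"
| "shift_cell (u, v) (Down a b) = Down (a + u) (b + v)"


section \<open>Pieces, tilings and atomic refinements\<close>

datatype 'v piece = Piece (cells: "cell set") (val: "edge \<rightharpoonup> 'v")

text \<open>
  A convex polygon with sides of integer length in the three lattice directions is, up to
  translation, the same as a nonempty finite union of unit triangles that is convex.
\<close>

definition is_piece :: "'v piece \<Rightarrow> bool" where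
  "is_piece p \<longleftrightarrow> finite (cells p) \<and> cells p \<noteq> {} \<and> convex (region (cells p)) \<and>
     dom (val p) = boundary (cells p)"

definition translate :: "int \<times> int \<Rightarrow> 'v piece \<Rightarrow> 'v piece" where
  "translate d p = Piece (shift_cell d ` cells p) (val p \<circ> shift_edge (- d))"

text \<open>
  A tiling is the set of its placed pieces, so that listing a piece of \<open>\<Omega>\<close> in several
  translated positions does not create additional tilings.
\<close>

definition is_tiling :: "'v piece set \<Rightarrow> 'v piece \<Rightarrow> 'v piece set \<Rightarrow> bool" where
  "is_tiling \<Omega> p T \<longleftrightarrow>
     (\<forall>t\<in>T. \<exists>w\<in>\<Omega>. \<exists>d. t = translate d w) \<and>
     (\<forall>s\<in>T. \<forall>t\<in>T. s \<noteq> t \<longrightarrow> cells s \<inter> cells t = {}) \<and>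
     (\<Union>t\<in>T. cells t) = cells p \<and>
     (\<forall>s\<in>T. \<forall>t\<in>T. \<forall>e \<in> dom (val s) \<inter> dom (val t). val s e = val t e) \<and>
     (\<forall>t\<in>T. \<forall>e \<in> dom (val t) \<inter> dom (val p). val t e = val p e)"

definition tilings :: "'v piece set \<Rightarrow> 'v piece \<Rightarrow> 'v piece set set" where
  "tilings \<Omega> p = {T. is_tiling \<Omega> p T}"

text \<open>The numeral types 2 and 3 are the prime fields with two and three elements.\<close>

definition f2_to_f3 :: "2 \<Rightarrow> 3" where
  "f2_to_f3 x = (if x = 0 then 0 else 1)"

definition unit_piece :: "cell \<Rightarrow> 'v \<Rightarrow> 'v \<Rightarrow> 'v \<Rightarrow> 'v piece" where
  "unit_piece c x y z = Piece {c} [sides c [\<mapsto>] [x, y, z]]"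

definition atomic_pieces :: "3 piece set" where
  "atomic_pieces = {unit_piece c x y z | c x y z. x + y + z = 0}"

text \<open>The existence of such a \<open>t\<close> includes that \<open>\<Omega>\<close> is refinable.\<close>

definition atomic_refinement :: "2 piece set \<Rightarrow> 3 piece set \<Rightarrow> bool" where
  "atomic_refinement \<Omega> \<Omega>' \<longleftrightarrow>
     (\<exists>t. (\<forall>p\<in>\<Omega>. t p \<in> tilings atomic_pieces (map_piece f2_to_f3 p)) \<and> \<Omega>' = (\<Union>p\<in>\<Omega>. t p))"


section \<open>The big triangle\<close>

definition triangle_cells :: "nat \<Rightarrow> cell set" where
  "triangle_cells n =
     {Up a b | a b. 0 \<le> a \<and> 0 \<le> b \<and> a + b < int n} \<union>
     {Down a b | a b. 0 \<le> a \<and> 0 \<le> b \<and> a + b + 1 < int n}"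

definition triangle_edges :: "nat \<Rightarrow> edge set" where
  "triangle_edges n = (\<Union>c\<in>triangle_cells n. set (sides c))"

text \<open>
  The j-th interval of each side, counted from 0 and from left to right: upwards on the left
  side, downwards on the right side.
\<close>

definition left_edge :: "nat \<Rightarrow> edge" where
  "left_edge j = Slash 0 (int j)"

definition right_edge :: "nat \<Rightarrow> nat \<Rightarrow> edge" where
  "right_edge n j = Backslash (int j) (int n - 1 - int j)"

definition bottom_edge :: "nat \<Rightarrow> edge" where
  "bottom_edge j = Horiz (int j) 0"

definition puzzle_triangle :: "nat \<Rightarrow> 'v list \<Rightarrow> 'v list \<Rightarrow> 'v list \<Rightarrow> 'v piece" where
  "puzzle_triangle n lam mu nu = Piece (triangle_cells n)
     [map left_edge [0..<n] [\<mapsto>] lam, map (right_edge n) [0..<n] [\<mapsto>] mu,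
      map bottom_edge [0..<n] [\<mapsto>] nu]"


section \<open>Polynomials over the field with three elements\<close>

type_synonym f3_poly = "(nat \<Rightarrow>\<^sub>0 nat) \<Rightarrow>\<^sub>0 3"

definition Const :: "3 \<Rightarrow> f3_poly" where
  "Const c = Poly_Mapping.single 0 c"

definition Var :: "nat \<Rightarrow> f3_poly" where
  "Var i = Poly_Mapping.single (Poly_Mapping.single i 1) 1"

definition vars :: "f3_poly \<Rightarrow> nat set" where
  "vars p = (\<Union>m\<in>Poly_Mapping.keys p. Poly_Mapping.keys m)"

text \<open>
  The value of a polynomial at \<open>v\<close> in a commutative ring that receives the coefficients by \<open>h\<close>.
\<close>

definition eval_via :: "(3 \<Rightarrow> 'r) \<Rightarrow> (nat \<Rightarrow> 'r) \<Rightarrow> f3_poly \<Rightarrow> 'r::comm_ring_1" where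
  "eval_via h v p = (\<Sum>m\<in>Poly_Mapping.keys p. h (Poly_Mapping.lookup p m) *
     (\<Prod>i\<in>Poly_Mapping.keys m. v i ^ Poly_Mapping.lookup m i))"

definition eval :: "(nat \<Rightarrow> 3) \<Rightarrow> f3_poly \<Rightarrow> 3" where
  "eval = eval_via id"

definition subst :: "(nat \<Rightarrow> f3_poly) \<Rightarrow> f3_poly \<Rightarrow> f3_poly" where
  "subst = eval_via Const"

text \<open>The polynomial ring in the variables with numbers 1, ..., m.\<close>

definition poly_ring :: "nat \<Rightarrow> f3_poly ring" where
  "poly_ring m = \<lparr>carrier = {p. vars p \<subseteq> {1..m}}, monoid.mult = (*), one = 1, zero = 0, add = (+)\<rparr>"

text \<open>
  \<open>Idl\<close> and \<open>Quot\<close> mean the generated ideal and the quotient ring only over a ring.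
\<close>

lemma vars_add: "vars (p + q) \<subseteq> vars p \<union> vars q"
  unfolding vars_def using Poly_Mapping.keys_add[of p q] by blast

lemma vars_uminus: "vars (- p) = vars p"
  by (simp add: vars_def)

lemma vars_mult: "vars (p * q) \<subseteq> vars p \<union> vars q"
proof
  fix i assume "i \<in> vars (p * q)"
  then obtain m where m: "m \<in> Poly_Mapping.keys (p * q)" "i \<in> Poly_Mapping.keys m"
    by (auto simp: vars_def)
  then obtain a b where ab: "m = a + b" "a \<in> Poly_Mapping.keys p" "b \<in> Poly_Mapping.keys q"
    using keys_mult[of p q] by auto
  then have "i \<in> Poly_Mapping.keys a \<union> Poly_Mapping.keys b"
    using m(2) Poly_Mapping.keys_add[of a b] by blast
  then show "i \<in> vars p \<union> vars q" using ab by (auto simp: vars_def)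
qed

lemma cring_poly_ring: "cring (poly_ring m)"
proof (rule cringI)
  show "abelian_group (poly_ring m)"
  proof (rule abelian_groupI)
    fix x assume "x \<in> carrier (poly_ring m)"
    then show "\<exists>y\<in>carrier (poly_ring m). y \<oplus>\<^bsub>poly_ring m\<^esub> x = \<zero>\<^bsub>poly_ring m\<^esub>"
      by (intro bexI[of _ "- x"]) (auto simp: poly_ring_def vars_uminus)
  next
    fix x y assume "x \<in> carrier (poly_ring m)" "y \<in> carrier (poly_ring m)"
    then show "x \<oplus>\<^bsub>poly_ring m\<^esub> y \<in> carrier (poly_ring m)"
      using vars_add[of x y] by (auto simp: poly_ring_def)
  qed (auto simp: poly_ring_def vars_def add_ac)
  show "comm_monoid (poly_ring m)"
  proof (rule comm_monoidI)
    fix x y assume "x \<in> carrier (poly_ring m)" "y \<in> carrier (poly_ring m)"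
    then show "x \<otimes>\<^bsub>poly_ring m\<^esub> y \<in> carrier (poly_ring m)"
      using vars_mult[of x y] by (auto simp: poly_ring_def)
  qed (auto simp: poly_ring_def vars_def mult_ac)
qed (auto simp: poly_ring_def algebra_simps)

definition variety :: "nat \<Rightarrow> f3_poly set \<Rightarrow> (nat \<Rightarrow> 3) set" where
  "variety m I = {v \<in> {1..m} \<rightarrow>\<^sub>E UNIV. \<forall>f\<in>I. eval v f = 0}"

definition field_equations :: "nat \<Rightarrow> f3_poly set" where
  "field_equations m = {Var i ^ 3 - Var i | i. i \<in> {1..m}}"


section \<open>Distinguishing polynomials\<close>

text \<open>The three variables of the ring are numbered 1, 2, 3.\<close>

definition reduced_ring :: "f3_poly set ring" where
  "reduced_ring = poly_ring 3 Quot (Idl\<^bsub>poly_ring 3\<^esub> (field_equations 3))"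

definition triple :: "'a \<Rightarrow> 'a \<Rightarrow> 'a \<Rightarrow> nat \<Rightarrow> 'a" where
  "triple x y z i = [x, y, z] ! (i - 1)"

text \<open>
  \<open>F\<close> is a residue class; its value at a point is the common value of its members. The position
  of the unit triangle in the plane is irrelevant, since pieces are used up to translation.
\<close>

definition upward_distinguishing :: "3 piece set \<Rightarrow> f3_poly set \<Rightarrow> bool" where
  "upward_distinguishing \<Omega>' F \<longleftrightarrow> F \<in> carrier reduced_ring \<and>
     (\<forall>f\<in>F. \<forall>x y z. x + y + z = 0 \<longrightarrow>
        (eval (triple x y z) f = 0 \<longleftrightarrow> (\<exists>a b. unit_piece (Up a b) x y z \<in> \<Omega>')))"

definition downward_distinguishing :: "3 piece set \<Rightarrow> f3_poly set \<Rightarrow> bool" where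
  "downward_distinguishing \<Omega>' F \<longleftrightarrow> F \<in> carrier reduced_ring \<and>
     (\<forall>f\<in>F. \<forall>x y z. x + y + z = 0 \<longrightarrow>
        (eval (triple x y z) f = 0 \<longleftrightarrow> (\<exists>a b. unit_piece (Down a b) x y z \<in> \<Omega>')))"


section \<open>The atomic puzzle ideal\<close>

definition num_edges :: "nat \<Rightarrow> nat" where
  "num_edges n = 3 * n * (n + 1) div 2"

lemma triangle_edges_eq:
  "triangle_edges n = (\<Union>(i, j)\<in>(SIGMA i:{..<n}. {..<n - i}). set (sides (Up (int i) (int j))))"
  (is "?L = ?R")
proof (intro equalityI subsetI)
  fix e assume "e \<in> ?R"
  then obtain i j where ij: "i < n" "j < n - i" "e \<in> set (sides (Up (int i) (int j)))"
    by blast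
  then have "Up (int i) (int j) \<in> triangle_cells n"
    by (auto simp: triangle_cells_def)
  then show "e \<in> ?L"
    using ij(3) unfolding triangle_edges_def by blast
next
  have *: "e \<in> ?R" if "e \<in> set (sides (Up a b))" "0 \<le> a" "0 \<le> b" "a + b < int n" for a b e
    by (rule UN_I[of "(nat a, nat b)"]) (use that in auto)
  fix e assume "e \<in> ?L"
  then obtain c where c: "c \<in> triangle_cells n" "e \<in> set (sides c)"
    unfolding triangle_edges_def by blast
  show "e \<in> ?R"
  proof (cases c)
    case (Up a b)
    then show ?thesis
      using c by (intro *[of e a b]) (auto simp: triangle_cells_def)
  next
    case (Down a b)
    then have ab: "0 \<le> a" "0 \<le> b" "a + b + 1 < int n"
      using c(1) by (auto simp: triangle_cells_def)
    consider "e \<in> set (sides (Up a b))" | "e \<in> set (sides (Up a (b + 1)))"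
      | "e \<in> set (sides (Up (a + 1) b))"
      using c(2) Down by auto
    then show ?thesis
    proof cases
      case 1
      then show ?thesis by (rule *) (use ab in auto)
    next
      case 2
      then show ?thesis by (rule *) (use ab in auto)
    next
      case 3
      then show ?thesis by (rule *) (use ab in auto)
    qed
  qed
qed

lemma card_triangle_edges: "card (triangle_edges n) = num_edges n"
proof -
  let ?S = "SIGMA i:{..<n}. {..<n - i}"
  have "card (triangle_edges n) = (\<Sum>(i,j)\<in>?S. card (set (sides (Up (int i) (int j)))))"
    unfolding triangle_edges_eq by (subst card_UN_disjoint) (auto simp: case_prod_unfold)
  also have "... = 3 * card ?S" by (simp add: case_prod_unfold)
  also have "card ?S = (\<Sum>i<n. n - i)" by simp
  also have "... = (\<Sum>i=1..n. i)"
    by (rule sum.reindex_bij_witness[of _ "\<lambda>i. n - i" "\<lambda>i. n - i"]) auto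
  also have "3 * ... = num_edges n"
  proof -
    have e: "2 * (\<Sum>i=1..n. i) = n * (n + 1)" by (induction n) auto
    then have "3 * n * (n + 1) = 2 * (3 * (\<Sum>i=1..n. i))" by simp
    then show ?thesis unfolding num_edges_def by simp
  qed
  finally show ?thesis .
qed

text \<open>\<open>idx\<close> numbers the unit intervals of the big triangle.\<close>

definition boundary_equations ::
  "nat \<Rightarrow> 2 list \<Rightarrow> 2 list \<Rightarrow> 2 list \<Rightarrow> (edge \<Rightarrow> nat) \<Rightarrow> f3_poly set" where
  "boundary_equations n lam mu nu idx =
     {Var (idx (left_edge j)) - Const (f2_to_f3 (lam ! j)) | j. j < n} \<union>
     {Var (idx (right_edge n j)) - Const (f2_to_f3 (mu ! j)) | j. j < n} \<union>
     {Var (idx (bottom_edge j)) - Const (f2_to_f3 (nu ! j)) | j. j < n}"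

definition sum_equations :: "nat \<Rightarrow> (edge \<Rightarrow> nat) \<Rightarrow> f3_poly set" where
  "sum_equations n idx = {\<Sum>e\<leftarrow>sides c. Var (idx e) | c. c \<in> triangle_cells n}"

definition side_vars :: "(edge \<Rightarrow> nat) \<Rightarrow> cell \<Rightarrow> nat \<Rightarrow> f3_poly" where
  "side_vars idx c i = Var (idx (sides c ! (i - 1)))"

definition piece_equations :: "nat \<Rightarrow> (edge \<Rightarrow> nat) \<Rightarrow> f3_poly \<Rightarrow> f3_poly \<Rightarrow> f3_poly set" where
  "piece_equations n idx fu fd =
     {subst (side_vars idx (Up a b)) fu | a b. Up a b \<in> triangle_cells n} \<union>
     {subst (side_vars idx (Down a b)) fd | a b. Down a b \<in> triangle_cells n}"

definition atomic_puzzle_ideal ::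
  "nat \<Rightarrow> 2 list \<Rightarrow> 2 list \<Rightarrow> 2 list \<Rightarrow> (edge \<Rightarrow> nat) \<Rightarrow> f3_poly \<Rightarrow> f3_poly \<Rightarrow> f3_poly set" where
  "atomic_puzzle_ideal n lam mu nu idx fu fd =
     Idl\<^bsub>poly_ring (num_edges n)\<^esub>
       (field_equations (num_edges n) \<union> boundary_equations n lam mu nu idx \<union>
        sum_equations n idx \<union> piece_equations n idx fu fd)"

end

theory Submission
  imports Defs
begin

text \<open>
  Both sides are identified with the labellings of the unit intervals of the big triangle by
  elements of the field with three elements that agree with the boundary values and induce on each
  unit triangle a translate of a piece of the refinement. A labelling determines the tiling
  consisting of the labelled unit triangles; conversely the values of the pieces of a tiling agree
  on common edges and so glue to a labelling. On the other side, a point is a zero of the ideal iff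
  it is a zero of the generators, and the sum and piece equations at a unit triangle say that its
  labels form an atomic piece at which the distinguishing polynomial vanishes.
\<close>

section \<open>Evaluation of polynomials\<close>

text \<open>The inner product of \<open>eval_via\<close> for \<open>h = id\<close>, named so that
  multiplicativity in the exponent vector can be stated.\<close>

definition monom_value :: "(nat \<Rightarrow> 3) \<Rightarrow> (nat \<Rightarrow>\<^sub>0 nat) \<Rightarrow> 3" where
  "monom_value v m = (\<Prod>i\<in>Poly_Mapping.keys m. v i ^ Poly_Mapping.lookup m i)"

text \<open>Exponents outside the keys are zero and contribute factors 1, so monomials with
  different keys can be compared over one index set.\<close>

lemma monom_value_superset:
  assumes "finite A" and "Poly_Mapping.keys m \<subseteq> A"
  shows "monom_value v m = (\<Prod>i\<in>A. v i ^ Poly_Mapping.lookup m i)"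
  unfolding monom_value_def
  by (rule prod.mono_neutral_left) (use assms in \<open>auto simp: in_keys_iff\<close>)

lemma monom_value_add: "monom_value v (a + b) = monom_value v a * monom_value v b"
proof -
  let ?A = "Poly_Mapping.keys a \<union> Poly_Mapping.keys b"
  have "Poly_Mapping.keys (a + b) \<subseteq> ?A"
    by (rule Poly_Mapping.keys_add)
  then show ?thesis
    by (simp add: monom_value_superset[of ?A] lookup_add power_add prod.distrib)
qed

lemma eval_eq_sum_monom_value:
  "eval v p = (\<Sum>m\<in>Poly_Mapping.keys p. Poly_Mapping.lookup p m * monom_value v m)"
  by (simp add: eval_def eval_via_def monom_value_def)

text \<open>Absent monomials have coefficient 0, so two polynomials can be evaluated over one common
  set of monomials.\<close>

lemma eval_superset:
  assumes "finite A" and "Poly_Mapping.keys p \<subseteq> A"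
  shows "eval v p = (\<Sum>m\<in>A. Poly_Mapping.lookup p m * monom_value v m)"
  unfolding eval_eq_sum_monom_value
  by (rule sum.mono_neutral_left) (use assms in \<open>auto simp: in_keys_iff\<close>)

lemma eval_add: "eval v (p + q) = eval v p + eval v q"
proof -
  let ?A = "Poly_Mapping.keys p \<union> Poly_Mapping.keys q"
  have "Poly_Mapping.keys (p + q) \<subseteq> ?A"
    by (rule Poly_Mapping.keys_add)
  then show ?thesis
    by (simp add: eval_superset[of ?A] lookup_add distrib_right sum.distrib)
qed

lemma eval_zero: "eval v 0 = 0"
  by (simp add: eval_eq_sum_monom_value)

lemma eval_uminus: "eval v (- p) = - eval v p"
  using eval_add[of v p "- p"] by (simp add: eval_zero eq_neg_iff_add_eq_0 add.commute)

lemma eval_diff: "eval v (p - q) = eval v p - eval v q"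
  using eval_add[of v p "- q"] by (simp add: eval_uminus)

lemma eval_sum: "eval v (\<Sum>i\<in>A. p i) = (\<Sum>i\<in>A. eval v (p i))"
  by (induction A rule: infinite_finite_induct) (auto simp: eval_zero eval_add)

lemma eval_single: "eval v (Poly_Mapping.single m c) = c * monom_value v m"
  by (simp add: eval_superset[of "{m}"])

lemma poly_mapping_eq_sum_single:
  "p = (\<Sum>m\<in>Poly_Mapping.keys p. Poly_Mapping.single m (Poly_Mapping.lookup p m))"
  by (rule poly_mapping_eqI) (auto simp: lookup_sum lookup_single when_def in_keys_iff)

text \<open>Expanding both factors into single terms reduces the claim to terms, where exponents add
  and coefficients multiply.\<close>

lemma eval_mult: "eval v (p * q) = eval v p * eval v q"
proof -
  let ?s = "\<lambda>p m. Poly_Mapping.single m (Poly_Mapping.lookup p m)"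
  have "p * q = (\<Sum>a\<in>Poly_Mapping.keys p. \<Sum>b\<in>Poly_Mapping.keys q. ?s p a * ?s q b)"
    unfolding sum_product[symmetric]
    by (rule arg_cong2[where f = "(*)"]) (rule poly_mapping_eq_sum_single)+
  then have "eval v (p * q) = (\<Sum>a\<in>Poly_Mapping.keys p. \<Sum>b\<in>Poly_Mapping.keys q.
      (Poly_Mapping.lookup p a * monom_value v a) * (Poly_Mapping.lookup q b * monom_value v b))"
    by (simp add: eval_sum mult_single eval_single monom_value_add mult_ac)
  then show ?thesis
    by (simp add: eval_eq_sum_monom_value sum_product)
qed

lemma eval_Const: "eval v (Const c) = c"
  by (simp add: Const_def eval_single monom_value_def)

lemma eval_Var: "eval v (Var i) = v i"
  by (simp add: Var_def eval_single monom_value_def)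

lemma eval_one: "eval v 1 = 1"
  using eval_Const[of v 1] by (simp add: Const_def)

lemma eval_prod: "eval v (\<Prod>i\<in>A. p i) = (\<Prod>i\<in>A. eval v (p i))"
  by (induction A rule: infinite_finite_induct) (auto simp: eval_one eval_mult)

lemma eval_power: "eval v (p ^ k) = eval v p ^ k"
  by (induction k) (auto simp: eval_one eval_mult)

lemma eval_sum_list: "eval v (\<Sum>e\<leftarrow>es. p e) = (\<Sum>e\<leftarrow>es. eval v (p e))"
  by (induction es) (auto simp: eval_zero eval_add)

text \<open>Evaluation at \<open>v\<close> is a ring homomorphism that fixes constants, hence it
  commutes with the sums, products and powers that make up \<open>subst\<close>.\<close>

lemma eval_subst: "eval v (subst s p) = eval (\<lambda>i. eval v (s i)) p"
  unfolding subst_def eval_via_def eval_sum eval_mult eval_prod eval_power eval_Const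
  by (simp add: eval_eq_sum_monom_value[of _ p] monom_value_def)

lemma eval_cong:
  assumes "\<And>i. i \<in> vars p \<Longrightarrow> v i = w i"
  shows "eval v p = eval w p"
  unfolding eval_eq_sum_monom_value monom_value_def
  by (intro sum.cong prod.cong arg_cong2[where f = "(*)"] arg_cong2[where f = "(^)"])
    (use assms in \<open>auto simp: vars_def\<close>)


section \<open>Variables of polynomials\<close>

lemma vars_zero: "vars 0 = {}"
  by (simp add: vars_def)

lemma vars_one: "vars 1 = {}"
  by (simp add: vars_def)

lemma vars_Const: "vars (Const c) = {}"
  by (simp add: vars_def Const_def)

lemma vars_Var: "vars (Var i) = {i}"
  by (simp add: vars_def Var_def)

lemma vars_diff: "vars (p - q) \<subseteq> vars p \<union> vars q"
  using vars_add[of p "- q"] by (simp add: vars_uminus)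

lemma vars_power: "vars (p ^ k) \<subseteq> vars p"
proof (induction k)
  case (Suc k)
  then show ?case using vars_mult[of p "p ^ k"] by auto
qed (simp add: vars_one)

lemma vars_sum: "vars (\<Sum>i\<in>A. p i) \<subseteq> (\<Union>i\<in>A. vars (p i))"
proof (induction A rule: infinite_finite_induct)
  case (insert x A)
  then show ?case using vars_add[of "p x" "sum p A"] by auto
qed (auto simp: vars_zero)

lemma vars_prod: "vars (\<Prod>i\<in>A. p i) \<subseteq> (\<Union>i\<in>A. vars (p i))"
proof (induction A rule: infinite_finite_induct)
  case (insert x A)
  then show ?case using vars_mult[of "p x" "prod p A"] by auto
qed (auto simp: vars_one)

lemma vars_sum_list: "vars (\<Sum>e\<leftarrow>es. p e) \<subseteq> (\<Union>e\<in>set es. vars (p e))"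
proof (induction es)
  case (Cons e es)
  then show ?case using vars_add[of "p e" "\<Sum>e\<leftarrow>es. p e"] by auto
qed (auto simp: vars_zero)

text \<open>Used to see that substituting interval variables into a distinguishing polynomial stays
  inside the polynomial ring of the puzzle.\<close>

lemma vars_subst: "vars (subst s p) \<subseteq> (\<Union>i\<in>vars p. vars (s i))"
proof -
  have mono: "vars (\<Prod>i\<in>Poly_Mapping.keys m. s i ^ Poly_Mapping.lookup m i)
      \<subseteq> (\<Union>i\<in>vars p. vars (s i))" if "m \<in> Poly_Mapping.keys p" for m
  proof -
    have "vars (\<Prod>i\<in>Poly_Mapping.keys m. s i ^ Poly_Mapping.lookup m i)
        \<subseteq> (\<Union>i\<in>Poly_Mapping.keys m. vars (s i ^ Poly_Mapping.lookup m i))"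
      by (rule vars_prod)
    also have "\<dots> \<subseteq> (\<Union>i\<in>Poly_Mapping.keys m. vars (s i))"
      using vars_power by (intro UN_mono) auto
    also have "\<dots> \<subseteq> (\<Union>i\<in>vars p. vars (s i))"
      using that by (auto simp: vars_def)
    finally show ?thesis .
  qed
  have "vars (Const c * (\<Prod>i\<in>Poly_Mapping.keys m. s i ^ Poly_Mapping.lookup m i))
      \<subseteq> (\<Union>i\<in>vars p. vars (s i))" if "m \<in> Poly_Mapping.keys p" for m c
    by (rule order_trans[OF vars_mult]) (use mono[OF that] in \<open>auto simp: vars_Const\<close>)
  then have "(\<Union>m\<in>Poly_Mapping.keys p. vars (Const (Poly_Mapping.lookup p m) *
      (\<Prod>i\<in>Poly_Mapping.keys m. s i ^ Poly_Mapping.lookup m i))) \<subseteq> (\<Union>i\<in>vars p. vars (s i))"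
    by blast
  then show ?thesis
    unfolding subst_def eval_via_def by (rule order_trans[OF vars_sum])
qed


section \<open>Varieties of generated ideals\<close>

text \<open>This is the kernel of evaluation at \<open>v\<close> on the ring, so additivity and
  multiplicativity of \<open>eval\<close> give the closure properties.\<close>

lemma ideal_zeros: "ideal {p \<in> carrier (poly_ring m). eval v p = 0} (poly_ring m)"
proof -
  interpret cring "poly_ring m" by (rule cring_poly_ring)
  \<comment> \<open>The additive inverse of the ring record is defined by a description, so it must
    first be identified with \<open>- p\<close>.\<close>
  have inv: "a_inv (poly_ring m) p = - p" if "p \<in> carrier (poly_ring m)" for p
    by (rule minus_equality) (use that in \<open>auto simp: poly_ring_def vars_uminus\<close>)
  show ?thesis
  proof (rule idealI)
    show "ring (poly_ring m)" by (rule ring_axioms)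
    show "subgroup {p \<in> carrier (poly_ring m). eval v p = 0} (add_monoid (poly_ring m))"
    proof (rule add.subgroupI)
      show "{p \<in> carrier (poly_ring m). eval v p = 0} \<noteq> {}"
        using eval_zero[of v] by (auto simp: poly_ring_def vars_zero intro!: exI[of _ 0])
    next
      fix p assume p: "p \<in> {p \<in> carrier (poly_ring m). eval v p = 0}"
      then show "\<ominus>\<^bsub>poly_ring m\<^esub> p \<in> {p \<in> carrier (poly_ring m). eval v p = 0}"
        by (simp add: inv eval_uminus) (simp add: poly_ring_def vars_uminus)
    next
      fix p q
      assume "p \<in> {p \<in> carrier (poly_ring m). eval v p = 0}"
        and "q \<in> {p \<in> carrier (poly_ring m). eval v p = 0}"
      then show "p \<oplus>\<^bsub>poly_ring m\<^esub> q \<in> {p \<in> carrier (poly_ring m). eval v p = 0}"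
        using vars_add[of p q] by (auto simp: poly_ring_def eval_add)
    qed auto
  next
    fix p q
    assume pq: "p \<in> {p \<in> carrier (poly_ring m). eval v p = 0}" "q \<in> carrier (poly_ring m)"
    show "q \<otimes>\<^bsub>poly_ring m\<^esub> p \<in> {p \<in> carrier (poly_ring m). eval v p = 0}"
      using pq vars_mult[of q p] by (auto simp: poly_ring_def eval_mult)
    show "p \<otimes>\<^bsub>poly_ring m\<^esub> q \<in> {p \<in> carrier (poly_ring m). eval v p = 0}"
      using pq vars_mult[of p q] by (auto simp: poly_ring_def eval_mult)
  qed
qed

text \<open>The polynomials vanishing at a point form an ideal, which contains the ideal generated
  by \<open>S\<close> as soon as it contains \<open>S\<close>.\<close>

lemma variety_genideal:
  assumes "S \<subseteq> carrier (poly_ring m)"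
  shows "variety m (Idl\<^bsub>poly_ring m\<^esub> S) = variety m S"
proof -
  interpret cring "poly_ring m" by (rule cring_poly_ring)
  have "(\<forall>f\<in>Idl\<^bsub>poly_ring m\<^esub> S. eval v f = 0) \<longleftrightarrow> (\<forall>f\<in>S. eval v f = 0)" for v
  proof
    assume "\<forall>f\<in>S. eval v f = 0"
    then have "Idl\<^bsub>poly_ring m\<^esub> S \<subseteq> {p \<in> carrier (poly_ring m). eval v p = 0}"
      using assms by (intro genideal_minimal ideal_zeros) auto
    then show "\<forall>f\<in>Idl\<^bsub>poly_ring m\<^esub> S. eval v f = 0" by auto
  qed (use genideal_self[OF assms] in blast)
  then show ?thesis
    unfolding variety_def by simp
qed

lemma field_equations_carrier: "field_equations m \<subseteq> carrier (poly_ring m)"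
proof
  fix p assume "p \<in> field_equations m"
  then obtain i where i: "p = Var i ^ 3 - Var i" "i \<in> {1..m}"
    unfolding field_equations_def by blast
  have "vars p \<subseteq> {i}"
    unfolding i(1) using vars_diff[of "Var i ^ 3" "Var i"] vars_power[of "Var i" 3]
    by (auto simp: vars_Var)
  then show "p \<in> carrier (poly_ring m)"
    using i(2) by (auto simp: poly_ring_def)
qed

text \<open>Classes in the quotient are cosets inside the ring in three variables. This matters
  since \<open>triple\<close> has no meaningful value at indices above 3.\<close>

lemma vars_reduced_ring:
  assumes "F \<in> carrier reduced_ring" and "f \<in> F"
  shows "vars f \<subseteq> {1..3}"
proof -
  interpret cring "poly_ring 3" by (rule cring_poly_ring)
  interpret ideal "Idl\<^bsub>poly_ring 3\<^esub> (field_equations 3)" "poly_ring 3"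
    by (intro genideal_ideal field_equations_carrier)
  have "F \<subseteq> carrier (poly_ring 3)"
    using assms(1) a_r_coset_subset_G[OF a_subset]
    by (auto simp: reduced_ring_def FactRing_def A_RCOSETS_def')
  then show ?thesis
    using assms(2) by (auto simp: poly_ring_def)
qed

text \<open>Fermat's little theorem for the prime 3; it makes the field equations hold at every
  point.\<close>

lemma f3_cube: "(x::3) ^ 3 = x"
proof -
  \<comment> \<open>\<open>exhaust_3\<close> lists 1, 2 and 3, and 3 equals 0 in this type.\<close>
  have "x \<in> {0, 1, 2}"
    using exhaust_3[of x] by auto
  then show ?thesis by auto
qed


section \<open>Labellings and tilings with unit triangles\<close>

definition labelled_cell :: "(edge \<Rightarrow> 'v) \<Rightarrow> cell \<Rightarrow> 'v piece" where
  "labelled_cell x c = unit_piece c (x (sides c ! 0)) (x (sides c ! 1)) (x (sides c ! 2))"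

definition cell_edges :: "cell set \<Rightarrow> edge set" where
  "cell_edges C = (\<Union>c\<in>C. set (sides c))"

text \<open>Tiles may sit anywhere, so a tiling sees \<Omega> only through this closure under
  translations.\<close>

definition translates :: "'v piece set \<Rightarrow> 'v piece set" where
  "translates \<Omega> = {translate d w | d w. w \<in> \<Omega>}"

text \<open>The intermediate set between points and tilings. Extensionality makes a labelling
  determined by its values on the edges of the cells of \<open>p\<close>.\<close>

definition labellings :: "'v piece set \<Rightarrow> 'v piece \<Rightarrow> (edge \<Rightarrow> 'v) set" where
  "labellings \<Omega> p = {x \<in> cell_edges (cells p) \<rightarrow>\<^sub>E UNIV.
     (\<forall>e\<in>dom (val p). val p e = Some (x e)) \<and> (\<forall>c\<in>cells p. labelled_cell x c \<in> translates \<Omega>)}"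

text \<open>The three sides of a cell are distinct edges, so the value map returns each of the three
  labels.\<close>

lemma unit_piece_eq_iff:
  "unit_piece c x y z = unit_piece c' x' y' z' \<longleftrightarrow> c = c' \<and> x = x' \<and> y = y' \<and> z = z'"
proof
  assume eq: "unit_piece c x y z = unit_piece c' x' y' z'"
  then have c: "c = c'" and "[sides c [\<mapsto>] [x, y, z]] = [sides c' [\<mapsto>] [x', y', z']]"
    by (auto simp: unit_piece_def)
  then have "[sides c [\<mapsto>] [x, y, z]] (sides c ! i) = [sides c [\<mapsto>] [x', y', z']] (sides c ! i)" for i
    by simp
  from this[of 0] this[of 1] this[of 2] c show "c = c' \<and> x = x' \<and> y = y' \<and> z = z'"
    by (cases c) auto
qed simp

lemma cells_unit_piece: "cells (unit_piece c x y z) = {c}"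
  by (simp add: unit_piece_def)

lemma cells_labelled_cell: "cells (labelled_cell x c) = {c}"
  by (simp add: labelled_cell_def cells_unit_piece)

lemma val_labelled_cell:
  "val (labelled_cell x c) = (\<lambda>e. if e \<in> set (sides c) then Some (x e) else None)"
  by (cases c) (auto simp: labelled_cell_def unit_piece_def fun_eq_iff)

lemma dom_val_labelled_cell: "dom (val (labelled_cell x c)) = set (sides c)"
  by (auto simp: val_labelled_cell dom_def)

lemma labelled_cell_cong:
  assumes "\<And>e. e \<in> set (sides c) \<Longrightarrow> x e = y e"
  shows "labelled_cell x c = labelled_cell y c"
  using assms by (cases c) (auto simp: labelled_cell_def)

lemma labelled_cell_eqD:
  assumes "labelled_cell x c = labelled_cell y c" and "e \<in> set (sides c)"
  shows "x e = y e"
proof -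
  have "val (labelled_cell x c) e = val (labelled_cell y c) e"
    using assms(1) by simp
  then show ?thesis
    using assms(2) by (simp add: val_labelled_cell)
qed

text \<open>Reading the value map back with \<open>the\<close> gives a labelling; its values away
  from the sides of \<open>c\<close> are irrelevant.\<close>

lemma unit_piece_labelled_cell: "\<exists>x. unit_piece c a b d = labelled_cell x c"
  by (rule exI[of _ "the \<circ> [sides c [\<mapsto>] [a, b, d]]"]; cases c) (auto simp: labelled_cell_def)

text \<open>Shifting takes the ordered sides of \<open>c\<close> to the ordered sides of the shifted
  cell, so labels keep their positions.\<close>

lemma translate_unit_piece:
  "translate d (unit_piece c x y z) = unit_piece (shift_cell d c) x y z"
proof (cases d)
  case (Pair u v)
  have "([sides c [\<mapsto>] [x, y, z]] \<circ> shift_edge (- d)) e = [sides (shift_cell d c) [\<mapsto>] [x, y, z]] e"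
    for e
    by (cases c; cases e) (auto simp: Pair)
  then show ?thesis
    by (auto simp: translate_def unit_piece_def)
qed

text \<open>With unit pieces only, a tile is a cell with labels, so gluing the values of the tiles
  inverts cutting along the cells. The assumption \<open>dom\<close> puts every prescribed value on
  a side of some tile.\<close>

lemma bij_betw_labellings_tilings:
  assumes unit: "\<And>w. w \<in> \<Omega> \<Longrightarrow> \<exists>c x y z. w = unit_piece c x y z"
    and dom: "dom (val p) \<subseteq> cell_edges (cells p)"
  shows "bij_betw (\<lambda>x. labelled_cell x ` cells p) (labellings \<Omega> p) (tilings \<Omega> p)"
  unfolding bij_betw_def
proof (intro conjI inj_onI equalityI subsetI)
  fix x y
  assume xy: "x \<in> labellings \<Omega> p" "y \<in> labellings \<Omega> p"
    "labelled_cell x ` cells p = labelled_cell y ` cells p"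
  \<comment> \<open>A tile records its cell, so the tile over \<open>c\<close> must come from
    \<open>c\<close> under both labellings.\<close>
  have "x e = y e" if c: "c \<in> cells p" and e: "e \<in> set (sides c)" for c e
  proof -
    obtain c' where c': "c' \<in> cells p" "labelled_cell x c = labelled_cell y c'"
      using xy(3) c by blast
    then have "c' = c"
      using cells_labelled_cell by (metis singleton_inject)
    then show ?thesis
      using c'(2) e labelled_cell_eqD by metis
  qed
  then have "x e = y e" if "e \<in> cell_edges (cells p)" for e
    using that by (auto simp: cell_edges_def)
  then show "x = y"
    using xy(1,2) by (intro PiE_ext[of x "cell_edges (cells p)" "\<lambda>_. UNIV" y])
      (auto simp: labellings_def)
next
  fix T assume "T \<in> (\<lambda>x. labelled_cell x ` cells p) ` labellings \<Omega> p"
  then obtain x where x: "x \<in> labellings \<Omega> p" and T: "T = labelled_cell x ` cells p"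
    by blast
  show "T \<in> tilings \<Omega> p"
    unfolding tilings_def is_tiling_def mem_Collect_eq
  proof (intro conjI)
    show "\<forall>t\<in>T. \<exists>w\<in>\<Omega>. \<exists>d. t = translate d w"
      using x by (fastforce simp: T labellings_def translates_def)
    show "\<forall>s\<in>T. \<forall>t\<in>T. s \<noteq> t \<longrightarrow> cells s \<inter> cells t = {}"
      by (auto simp: T cells_labelled_cell)
    show "(\<Union>t\<in>T. cells t) = cells p"
      by (auto simp: T cells_labelled_cell)
    show "\<forall>s\<in>T. \<forall>t\<in>T. \<forall>e\<in>dom (val s) \<inter> dom (val t). val s e = val t e"
      by (auto simp: T val_labelled_cell split: if_splits)
    show "\<forall>t\<in>T. \<forall>e\<in>dom (val t) \<inter> dom (val p). val t e = val p e"
    proof (intro ballI)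
      fix t e assume t: "t \<in> T" and e: "e \<in> dom (val t) \<inter> dom (val p)"
      then have "val p e = Some (x e)"
        using x by (auto simp: labellings_def)
      moreover have "val t e = Some (x e)"
        using t e by (auto simp: T val_labelled_cell split: if_splits)
      ultimately show "val t e = val p e" by simp
    qed
  qed
next
  fix T assume "T \<in> tilings \<Omega> p"
  then have tiling: "\<forall>t\<in>T. \<exists>w\<in>\<Omega>. \<exists>d. t = translate d w" "(\<Union>t\<in>T. cells t) = cells p"
    "\<forall>s\<in>T. \<forall>t\<in>T. \<forall>e\<in>dom (val s) \<inter> dom (val t). val s e = val t e"
    "\<forall>t\<in>T. \<forall>e\<in>dom (val t) \<inter> dom (val p). val t e = val p e"
    unfolding tilings_def is_tiling_def mem_Collect_eq by - (elim conjE, assumption)+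
  have transl: "t \<in> translates \<Omega>" if "t \<in> T" for t
    using tiling(1) that unfolding translates_def by blast
  note cover = tiling(2)
  have agree: "val s e = val t e"
    if "s \<in> T" "t \<in> T" "e \<in> dom (val s)" "e \<in> dom (val t)" for s t e
    using tiling(3) that by (meson IntI)
  have bd: "val t e = val p e" if "t \<in> T" "e \<in> dom (val t)" "e \<in> dom (val p)" for t e
    using tiling(4) that by (meson IntI)
  have cell: "\<exists>c x. t = labelled_cell x c" if "t \<in> T" for t
  proof -
    obtain d w where w: "w \<in> \<Omega>" "t = translate d w"
      using tiling(1) \<open>t \<in> T\<close> by blast
    from unit[OF w(1)] obtain c y1 y2 y3 where "w = unit_piece c y1 y2 y3"
      by blast
    with w(2) have t: "t = unit_piece (shift_cell d c) y1 y2 y3"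
      by (simp add: translate_unit_piece)
    show ?thesis
      unfolding t using unit_piece_labelled_cell[of "shift_cell d c" y1 y2 y3] by (rule exI)
  qed
  \<comment> \<open>Any tile with \<open>e\<close> on its boundary may be chosen, since tiles agree
    on common edges. Off the edges of the cells of \<open>p\<close> the value is
    \<open>undefined\<close>, as extensionality demands.\<close>
  define x where "x = (\<lambda>e\<in>cell_edges (cells p). the (val (SOME t. t \<in> T \<and> e \<in> dom (val t)) e))"
  have x: "val t e = Some (x e)" if t: "t \<in> T" "e \<in> dom (val t)" for t e
  proof -
    let ?s = "SOME t. t \<in> T \<and> e \<in> dom (val t)"
    obtain c y where cy: "t = labelled_cell y c"
      using cell t(1) by blast
    then have "c \<in> cells t" "e \<in> set (sides c)"
      using t(2) by (auto simp: cells_labelled_cell dom_val_labelled_cell)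
    then have "c \<in> cells p" "e \<in> set (sides c)"
      using cover t(1) by blast+
    then have e: "e \<in> cell_edges (cells p)"
      by (auto simp: cell_edges_def)
    have s: "?s \<in> T \<and> e \<in> dom (val ?s)"
      by (rule someI[of _ t]) (use t in blast)
    then have "val t e = val ?s e"
      by (intro agree t) simp_all
    also have "\<dots> = Some (x e)"
      using e s by (simp add: x_def domIff)
    finally show ?thesis .
  qed
  \<comment> \<open>A tile is a single cell with labels, and \<open>x\<close> reproduces these
    labels.\<close>
  have T: "t = labelled_cell x c" if t: "t \<in> T" "c \<in> cells t" for t c
  proof -
    obtain c' y where cy: "t = labelled_cell y c'"
      using cell t(1) by blast
    then have "c' = c"
      using t(2) by (simp add: cells_labelled_cell)
    moreover have "y e = x e" if "e \<in> set (sides c')" for e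
      using x[OF t(1), of e] that by (simp add: cy dom_val_labelled_cell) (simp add: val_labelled_cell)
    ultimately show ?thesis
      using labelled_cell_cong[of c y x] cy by simp
  qed
  have mem: "labelled_cell x c \<in> T" if c: "c \<in> cells p" for c
  proof -
    obtain t where "t \<in> T" "c \<in> cells t"
      using c cover by blast
    then show ?thesis using T by metis
  qed
  have "x \<in> labellings \<Omega> p"
    unfolding labellings_def mem_Collect_eq
  proof (intro conjI ballI)
    show "x \<in> cell_edges (cells p) \<rightarrow>\<^sub>E UNIV"
      by (auto simp: x_def)
    \<comment> \<open>A prescribed edge is a side of a cell of \<open>p\<close>, and the tile on
      that cell carries both the value of \<open>p\<close> and that of \<open>x\<close>.\<close>
    fix e assume e: "e \<in> dom (val p)"
    then obtain c where c: "c \<in> cells p" "e \<in> set (sides c)"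
      using dom by (auto simp: cell_edges_def)
    then have "e \<in> dom (val (labelled_cell x c))"
      by (simp add: dom_val_labelled_cell)
    then show "val p e = Some (x e)"
      using mem[OF c(1)] bd x e by metis
  next
    fix c assume "c \<in> cells p"
    then show "labelled_cell x c \<in> translates \<Omega>"
      using mem transl by blast
  qed
  moreover have "T = labelled_cell x ` cells p"
  proof (intro equalityI subsetI)
    fix t assume t: "t \<in> T"
    then obtain c y where "t = labelled_cell y c"
      using cell by blast
    then have c: "c \<in> cells t"
      by (simp add: cells_labelled_cell)
    then show "t \<in> labelled_cell x ` cells p"
      using T[OF t c] t cover by blast
  qed (use mem in auto)
  ultimately show "T \<in> (\<lambda>x. labelled_cell x ` cells p) ` labellings \<Omega> p"
    by blast
qed


section \<open>Points of the variety as labellings\<close>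

text \<open>Translation moves the cell and keeps the labels, so the zero sum survives when an atomic
  piece is placed in a tiling.\<close>

lemma atomic_refinement_subset:
  assumes "atomic_refinement \<Omega> \<Omega>'"
  shows "\<Omega>' \<subseteq> atomic_pieces"
proof
  fix w assume "w \<in> \<Omega>'"
  then obtain p T where "is_tiling atomic_pieces p T" "w \<in> T"
    using assms unfolding atomic_refinement_def tilings_def by blast
  then obtain v d where "v \<in> atomic_pieces" "w = translate d v"
    unfolding is_tiling_def by metis
  then obtain c x y z where "w = unit_piece (shift_cell d c) x y z" "x + y + z = 0"
    by (auto simp: atomic_pieces_def translate_unit_piece)
  then show "w \<in> atomic_pieces"
    unfolding atomic_pieces_def by blast
qed

text \<open>Translation preserves orientation and labels, and any two upward cells differ by a
  translation. The sum condition appears on the right because the distinguishing property is stated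
  for zero-sum triples.\<close>

lemma unit_piece_Up_translates_iff:
  assumes "\<Omega> \<subseteq> atomic_pieces"
  shows "unit_piece (Up a b) x y z \<in> translates \<Omega> \<longleftrightarrow>
    x + y + z = 0 \<and> (\<exists>a b. unit_piece (Up a b) x y z \<in> \<Omega>)"
proof
  assume "unit_piece (Up a b) x y z \<in> translates \<Omega>"
  then obtain d w where w: "w \<in> \<Omega>" "unit_piece (Up a b) x y z = translate d w"
    unfolding translates_def by blast
  then obtain c x' y' z' where c: "w = unit_piece c x' y' z'" "x' + y' + z' = 0"
    using assms by (auto simp: atomic_pieces_def)
  then show "x + y + z = 0 \<and> (\<exists>a b. unit_piece (Up a b) x y z \<in> \<Omega>)"
    using w by (cases d; cases c) (auto simp: translate_unit_piece unit_piece_eq_iff)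
next
  assume "x + y + z = 0 \<and> (\<exists>a b. unit_piece (Up a b) x y z \<in> \<Omega>)"
  then obtain a' b' where w: "unit_piece (Up a' b') x y z \<in> \<Omega>"
    by blast
  have "unit_piece (Up a b) x y z = translate (a - a', b - b') (unit_piece (Up a' b') x y z)"
    by (simp add: translate_unit_piece)
  then show "unit_piece (Up a b) x y z \<in> translates \<Omega>"
    using w unfolding translates_def by blast
qed

text \<open>Holds for the same reason as in the upward case.\<close>

lemma unit_piece_Down_translates_iff:
  assumes "\<Omega> \<subseteq> atomic_pieces"
  shows "unit_piece (Down a b) x y z \<in> translates \<Omega> \<longleftrightarrow>
    x + y + z = 0 \<and> (\<exists>a b. unit_piece (Down a b) x y z \<in> \<Omega>)"
proof
  assume "unit_piece (Down a b) x y z \<in> translates \<Omega>"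
  then obtain d w where w: "w \<in> \<Omega>" "unit_piece (Down a b) x y z = translate d w"
    unfolding translates_def by blast
  then obtain c x' y' z' where c: "w = unit_piece c x' y' z'" "x' + y' + z' = 0"
    using assms by (auto simp: atomic_pieces_def)
  then show "x + y + z = 0 \<and> (\<exists>a b. unit_piece (Down a b) x y z \<in> \<Omega>)"
    using w by (cases d; cases c) (auto simp: translate_unit_piece unit_piece_eq_iff)
next
  assume "x + y + z = 0 \<and> (\<exists>a b. unit_piece (Down a b) x y z \<in> \<Omega>)"
  then obtain a' b' where w: "unit_piece (Down a' b') x y z \<in> \<Omega>"
    by blast
  have "unit_piece (Down a b) x y z = translate (a - a', b - b') (unit_piece (Down a' b') x y z)"
    by (simp add: translate_unit_piece)
  then show "unit_piece (Down a b) x y z \<in> translates \<Omega>"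
    using w unfolding translates_def by blast
qed

text \<open>Index \<open>i\<close> addresses list position \<open>i - 1\<close> in
  \<open>side_vars\<close> and in \<open>triple\<close> alike, so substitution amounts to evaluation
  at the labels.\<close>

lemma eval_subst_side_vars:
  assumes "vars f \<subseteq> {1..3}"
  shows "eval v (subst (side_vars idx c) f) =
    eval (triple (v (idx (sides c ! 0))) (v (idx (sides c ! 1))) (v (idx (sides c ! 2)))) f"
  unfolding eval_subst
proof (rule eval_cong)
  fix i assume "i \<in> vars f"
  then have "i \<in> {1, 2, 3}" using assms by fastforce
  then show "eval v (side_vars idx c i) =
      triple (v (idx (sides c ! 0))) (v (idx (sides c ! 1))) (v (idx (sides c ! 2))) i"
    by (auto simp: side_vars_def eval_Var triple_def)
qed

lemma sum_list_sides:
  fixes g :: "edge \<Rightarrow> 'a::comm_monoid_add"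
  shows "(\<Sum>e\<leftarrow>sides c. g e) = g (sides c ! 0) + g (sides c ! 1) + g (sides c ! 2)"
  by (cases c) (simp_all add: add.assoc)

text \<open>Local form of the correspondence: the linear equation says that the labelled triangle is
  atomic, and the polynomial then decides membership up to translation.\<close>

lemma labelled_cell_translates_iff:
  assumes "\<Omega> \<subseteq> atomic_pieces"
    and "upward_distinguishing \<Omega> Fu" and "fu \<in> Fu"
    and "downward_distinguishing \<Omega> Fd" and "fd \<in> Fd"
  shows "labelled_cell (v \<circ> idx) c \<in> translates \<Omega> \<longleftrightarrow>
    eval v (\<Sum>e\<leftarrow>sides c. Var (idx e)) = 0 \<and>
    eval v (subst (side_vars idx c) (case c of Up _ _ \<Rightarrow> fu | Down _ _ \<Rightarrow> fd)) = 0"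
proof -
  have vars: "vars fu \<subseteq> {1..3}" "vars fd \<subseteq> {1..3}"
    using assms(2-5) vars_reduced_ring
    unfolding upward_distinguishing_def downward_distinguishing_def by blast+
  have up: "eval (triple x y z) fu = 0 \<longleftrightarrow> (\<exists>a b. unit_piece (Up a b) x y z \<in> \<Omega>)"
    and down: "eval (triple x y z) fd = 0 \<longleftrightarrow> (\<exists>a b. unit_piece (Down a b) x y z \<in> \<Omega>)"
    if "x + y + z = 0" for x y z
    using assms(2-5) that
    unfolding upward_distinguishing_def downward_distinguishing_def by blast+
  \<comment> \<open>The equivalences \<open>up\<close> and \<open>down\<close> assume zero sum;
    \<open>conj_cong\<close> makes the first conjunct available while the second is
    rewritten.\<close>
  show ?thesis
    unfolding labelled_cell_def eval_sum_list eval_Var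
    unfolding sum_list_sides
    using vars up down
    by (cases c) (simp_all only: cell.case eval_subst_side_vars comp_apply
        unit_piece_Up_translates_iff[OF assms(1)] unit_piece_Down_translates_iff[OF assms(1)]
        cong: conj_cong)
qed

section \<open>Boundary values of the big triangle\<close>

lemma map_upds_map_upt:
  assumes "inj_on g {..<n}" and "length ys = n"
  shows "j < n \<Longrightarrow> (m(map g [0..<n] [\<mapsto>] ys)) (g j) = Some (ys ! j)"
    and "e \<notin> g ` {..<n} \<Longrightarrow> (m(map g [0..<n] [\<mapsto>] ys)) e = m e"
proof -
  have *: "j < n \<longrightarrow> (m(map g [0..<n] [\<mapsto>] ys)) (g j) = Some (ys ! j)"
    using assms
  proof (induction n arbitrary: ys)
    case (Suc n)
    \<comment> \<open>Splitting off the last value matches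
      \<open>[0..<Suc n] = [0..<n] @ [n]\<close>; injectivity keeps the update at \<open>g n\<close>
      from overwriting earlier ones.\<close>
    obtain zs z where ys: "ys = zs @ [z]" "length zs = n"
      using Suc.prems(2) by (metis length_Suc_conv_rev)
    have inj: "inj_on g {..<n}" and neq: "g j \<noteq> g n" if "j < n"
      using Suc.prems(1) that by (auto simp: inj_on_def)
    show ?case
      using Suc.IH[OF _ ys(2)] inj neq ys(2)
      by (auto simp: ys(1) map_upds_def less_Suc_eq nth_append)
  qed simp
  then show "j < n \<Longrightarrow> (m(map g [0..<n] [\<mapsto>] ys)) (g j) = Some (ys ! j)" by simp
  show "e \<notin> g ` {..<n} \<Longrightarrow> (m(map g [0..<n] [\<mapsto>] ys)) e = m e"
    by (rule map_upds_apply_nontin) (auto simp: lessThan_atLeast0)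
qed

text \<open>Left, right and bottom intervals are different kinds of edges, so the three successive
  updates do not interfere.\<close>

lemma val_puzzle_triangle:
  assumes "length lam = n" and "length mu = n" and "length nu = n"
  shows "j < n \<Longrightarrow> val (puzzle_triangle n lam mu nu) (left_edge j) = Some (lam ! j)"
    and "j < n \<Longrightarrow> val (puzzle_triangle n lam mu nu) (right_edge n j) = Some (mu ! j)"
    and "j < n \<Longrightarrow> val (puzzle_triangle n lam mu nu) (bottom_edge j) = Some (nu ! j)"
    and "dom (val (puzzle_triangle n lam mu nu)) =
      left_edge ` {..<n} \<union> right_edge n ` {..<n} \<union> bottom_edge ` {..<n}"
proof -
  have inj: "inj_on left_edge {..<n}" "inj_on (right_edge n) {..<n}" "inj_on bottom_edge {..<n}"
    by (auto simp: inj_on_def left_edge_def right_edge_def bottom_edge_def)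
  have neq: "left_edge j \<notin> right_edge n ` A" "left_edge j \<notin> bottom_edge ` A"
    "right_edge n j \<notin> bottom_edge ` A" for j A
    by (auto simp: left_edge_def right_edge_def bottom_edge_def)
  show "j < n \<Longrightarrow> val (puzzle_triangle n lam mu nu) (left_edge j) = Some (lam ! j)"
    and "j < n \<Longrightarrow> val (puzzle_triangle n lam mu nu) (right_edge n j) = Some (mu ! j)"
    and "j < n \<Longrightarrow> val (puzzle_triangle n lam mu nu) (bottom_edge j) = Some (nu ! j)"
    using map_upds_map_upt(1)[OF inj(1) assms(1)] map_upds_map_upt(1)[OF inj(2) assms(2)]
      map_upds_map_upt(1)[OF inj(3) assms(3)] neq
    by (simp_all add: puzzle_triangle_def map_upds_map_upt(2)[OF inj(2) assms(2)]
        map_upds_map_upt(2)[OF inj(3) assms(3)])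
  show "dom (val (puzzle_triangle n lam mu nu)) =
      left_edge ` {..<n} \<union> right_edge n ` {..<n} \<union> bottom_edge ` {..<n}"
    using assms by (auto simp: puzzle_triangle_def lessThan_atLeast0)
qed

lemma val_map_piece: "val (map_piece f p) = map_option f \<circ> val p"
  by (cases p) simp

lemma cells_map_piece: "cells (map_piece f p) = cells p"
  by (cases p) simp

lemma boundary_edges_subset:
  "left_edge ` {..<n} \<union> right_edge n ` {..<n} \<union> bottom_edge ` {..<n} \<subseteq> triangle_edges n"
proof -
  have "left_edge j \<in> triangle_edges n" "right_edge n j \<in> triangle_edges n"
    "bottom_edge j \<in> triangle_edges n" if "j < n" for j
  proof -
    \<comment> \<open>Each boundary interval is a side of the upward cell that rests against
      it.\<close>
    have "Up 0 (int j) \<in> triangle_cells n" "Up (int j) (int n - 1 - int j) \<in> triangle_cells n"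
      "Up (int j) 0 \<in> triangle_cells n"
      using that by (auto simp: triangle_cells_def)
    then show "left_edge j \<in> triangle_edges n" "right_edge n j \<in> triangle_edges n"
      "bottom_edge j \<in> triangle_edges n"
      unfolding triangle_edges_def left_edge_def right_edge_def bottom_edge_def by force+
  qed
  then show ?thesis by auto
qed

text \<open>Each generator is linear in one variable and forces it to the embedded prescribed value;
  together they exhaust the domain of the boundary map.\<close>

lemma boundary_equations_iff:
  assumes "length lam = n" and "length mu = n" and "length nu = n"
  shows "(\<forall>f\<in>boundary_equations n lam mu nu idx. eval v f = 0) \<longleftrightarrow>
    (\<forall>e\<in>dom (val (map_piece f2_to_f3 (puzzle_triangle n lam mu nu))).
      val (map_piece f2_to_f3 (puzzle_triangle n lam mu nu)) e = Some (v (idx e)))"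
  (is "?L \<longleftrightarrow> ?R")
proof -
  have "?L \<longleftrightarrow> (\<forall>j<n. v (idx (left_edge j)) = f2_to_f3 (lam ! j) \<and>
      v (idx (right_edge n j)) = f2_to_f3 (mu ! j) \<and> v (idx (bottom_edge j)) = f2_to_f3 (nu ! j))"
    unfolding boundary_equations_def
    by (auto simp: setcompr_eq_image eval_diff eval_Var eval_Const ball_Un)
  also have "\<dots> \<longleftrightarrow> ?R"
    using val_puzzle_triangle[OF assms]
    by (auto simp: val_map_piece dom_map_option_comp ball_Un simp del: map_option_eq_Some)
  finally show ?thesis .
qed

section \<open>The generators of the ideal and their common zeros\<close>

lemma puzzle_generators_carrier:
  assumes "vars fu \<subseteq> {1..3}" and "vars fd \<subseteq> {1..3}"
    and "idx ` triangle_edges n \<subseteq> {1..m}"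
  shows "field_equations m \<union> boundary_equations n lam mu nu idx \<union>
    sum_equations n idx \<union> piece_equations n idx fu fd \<subseteq> carrier (poly_ring m)"
proof -
  have idx: "idx e \<in> {1..m}" if "e \<in> triangle_edges n" for e
    using assms(3) that by blast
  have sides: "idx e \<in> {1..m}" if "c \<in> triangle_cells n" "e \<in> set (sides c)" for c e
    using that by (intro idx) (auto simp: triangle_edges_def)
  have "vars f \<subseteq> {1..m}" if "f \<in> field_equations m" for f
    using that field_equations_carrier by (auto simp: poly_ring_def)
  moreover have "vars f \<subseteq> {1..m}" if f: "f \<in> boundary_equations n lam mu nu idx" for f
  proof -
    obtain e c where "f = Var (idx e) - Const c" "e \<in> triangle_edges n"
      using f boundary_edges_subset[of n] by (fastforce simp: boundary_equations_def)
    then show ?thesis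
      using vars_diff[of "Var (idx e)" "Const c"] idx[of e] by (auto simp: vars_Var vars_Const)
  qed
  moreover have "vars f \<subseteq> {1..m}" if f: "f \<in> sum_equations n idx" for f
  proof -
    obtain c where c: "f = (\<Sum>e\<leftarrow>sides c. Var (idx e))" "c \<in> triangle_cells n"
      using f by (auto simp: sum_equations_def)
    then show ?thesis
      using vars_sum_list[of "\<lambda>e. Var (idx e)" "sides c"] sides[OF c(2)]
      by (fastforce simp: vars_Var)
  qed
  moreover have "vars f \<subseteq> {1..m}" if f: "f \<in> piece_equations n idx fu fd" for f
  proof -
    obtain c g where c: "f = subst (side_vars idx c) g" "c \<in> triangle_cells n" "vars g \<subseteq> {1..3}"
      using f assms(1,2) unfolding piece_equations_def by blast
    have "vars (side_vars idx c i) \<subseteq> {1..m}" if "i \<in> vars g" for i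
    proof -
      \<comment> \<open>Truncated subtraction makes \<open>i - 1\<close> a valid list position for
        every \<open>i\<close> up to 3, including 0.\<close>
      have "i \<le> 3"
        using that c(3) by auto
      then have "i - 1 < length (sides c)"
        by (cases c) auto
      then have "sides c ! (i - 1) \<in> set (sides c)"
        by (rule nth_mem)
      from sides[OF c(2) this] show ?thesis
        by (simp add: side_vars_def vars_Var)
    qed
    then show ?thesis
      unfolding c(1) using vars_subst[of "side_vars idx c" g] by blast
  qed
  ultimately show ?thesis
    unfolding poly_ring_def partial_object.simps by blast
qed

text \<open>Passing to generators splits the condition by family: field equations always hold,
  boundary equations give the prescribed values, and sum and piece equations together give the
  condition on cells.\<close>

lemma variety_atomic_puzzle_ideal:
  assumes "length lam = n" and "length mu = n" and "length nu = n"
    and "\<Omega> \<subseteq> atomic_pieces"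
    and "upward_distinguishing \<Omega> Fu" and "fu \<in> Fu"
    and "downward_distinguishing \<Omega> Fd" and "fd \<in> Fd"
    and "idx ` triangle_edges n \<subseteq> {1..num_edges n}"
  shows "variety (num_edges n) (atomic_puzzle_ideal n lam mu nu idx fu fd) =
    {v \<in> {1..num_edges n} \<rightarrow>\<^sub>E UNIV. restrict (v \<circ> idx) (triangle_edges n) \<in>
      labellings \<Omega> (map_piece f2_to_f3 (puzzle_triangle n lam mu nu))}"
proof -
  let ?p = "map_piece f2_to_f3 (puzzle_triangle n lam mu nu)"
  have vars: "vars fu \<subseteq> {1..3}" "vars fd \<subseteq> {1..3}"
    using assms(5-8) vars_reduced_ring
    unfolding upward_distinguishing_def downward_distinguishing_def by blast+
  have cells: "cells ?p = triangle_cells n"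
    by (simp add: cells_map_piece puzzle_triangle_def)
  have edges: "cell_edges (triangle_cells n) = triangle_edges n"
    by (simp add: cell_edges_def triangle_edges_def)
  have dom: "dom (val ?p) \<subseteq> triangle_edges n"
    using boundary_edges_subset[of n]
    by (simp add: val_map_piece dom_map_option_comp val_puzzle_triangle[OF assms(1-3)])
  have "(\<forall>f\<in>field_equations (num_edges n) \<union> boundary_equations n lam mu nu idx \<union>
        sum_equations n idx \<union> piece_equations n idx fu fd. eval v f = 0) \<longleftrightarrow>
      restrict (v \<circ> idx) (triangle_edges n) \<in> labellings \<Omega> ?p" (is "?L \<longleftrightarrow> ?R") for v
  proof -
    have "\<forall>f\<in>field_equations (num_edges n). eval v f = 0"
      by (auto simp: field_equations_def eval_diff eval_power eval_Var f3_cube)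
    moreover have "(\<forall>f\<in>boundary_equations n lam mu nu idx. eval v f = 0) \<longleftrightarrow>
        (\<forall>e\<in>dom (val ?p). val ?p e = Some (restrict (v \<circ> idx) (triangle_edges n) e))"
      unfolding boundary_equations_iff[OF assms(1-3)]
      by (rule ball_cong[OF refl]) (use dom in auto)
    moreover have "(\<forall>f\<in>sum_equations n idx \<union> piece_equations n idx fu fd. eval v f = 0) \<longleftrightarrow>
        (\<forall>c\<in>triangle_cells n. labelled_cell (restrict (v \<circ> idx) (triangle_edges n)) c
          \<in> translates \<Omega>)"
    proof -
      \<comment> \<open>Both orientations are merged into one family indexed by cells, to pair each
        piece equation with the sum equation of the same cell.\<close>
      have pieces: "piece_equations n idx fu fd = {subst (side_vars idx c)
          (case c of Up _ _ \<Rightarrow> fu | Down _ _ \<Rightarrow> fd) | c. c \<in> triangle_cells n}"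
        (is "_ = ?P")
      proof (intro equalityI subsetI)
        fix f assume "f \<in> piece_equations n idx fu fd"
        then show "f \<in> ?P"
          unfolding piece_equations_def by force
      next
        fix f assume "f \<in> ?P"
        then obtain c where "f = subst (side_vars idx c) (case c of Up _ _ \<Rightarrow> fu | Down _ _ \<Rightarrow> fd)"
          "c \<in> triangle_cells n"
          by blast
        then show "f \<in> piece_equations n idx fu fd"
          unfolding piece_equations_def by (cases c) auto
      qed
      \<comment> \<open>A cell of the triangle reads only edges of the triangle, so the restriction
        is invisible to it.\<close>
      have "labelled_cell (restrict (v \<circ> idx) (triangle_edges n)) c = labelled_cell (v \<circ> idx) c"
        if "c \<in> triangle_cells n" for c
        by (rule labelled_cell_cong) (use that in \<open>auto simp: triangle_edges_def\<close>)
      then have "(\<forall>c\<in>triangle_cells n. labelled_cell (restrict (v \<circ> idx) (triangle_edges n)) c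
            \<in> translates \<Omega>) \<longleftrightarrow>
          (\<forall>c\<in>triangle_cells n. eval v (\<Sum>e\<leftarrow>sides c. Var (idx e)) = 0 \<and>
            eval v (subst (side_vars idx c) (case c of Up _ _ \<Rightarrow> fu | Down _ _ \<Rightarrow> fd)) = 0)"
        using labelled_cell_translates_iff[OF assms(4-8)] by simp
      then show ?thesis
        unfolding pieces sum_equations_def by blast
    qed
    moreover have "restrict (v \<circ> idx) (triangle_edges n) \<in> triangle_edges n \<rightarrow>\<^sub>E UNIV"
      by simp
    ultimately show ?thesis
      unfolding labellings_def cells edges mem_Collect_eq ball_Un by blast
  qed
  then show ?thesis
    unfolding atomic_puzzle_ideal_def
      variety_genideal[OF puzzle_generators_carrier[OF vars assms(9)]]
    unfolding variety_def by simp
qed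

section \<open>Renumbering of coordinates and the composed bijection\<close>

lemma bij_betw_restrict_comp:
  fixes g :: "'a \<Rightarrow> 'b"
  assumes "bij_betw g A B"
  shows "bij_betw (\<lambda>v. restrict (v \<circ> g) A) (B \<rightarrow>\<^sub>E (UNIV :: 'c set)) (A \<rightarrow>\<^sub>E UNIV)"
\<comment> \<open>The inverse pulls back along \<open>inv_into A g\<close>; the restrictions to
  \<open>A\<close> and \<open>B\<close> keep both maps inside the extensional functions.\<close>
proof (rule bij_betw_byWitness[where f' = "\<lambda>x. restrict (x \<circ> inv_into A g) B"])
  show "\<forall>v\<in>B \<rightarrow>\<^sub>E (UNIV :: 'c set). restrict (restrict (v \<circ> g) A \<circ> inv_into A g) B = v"
  proof
    fix v :: "'b \<Rightarrow> 'c" assume "v \<in> B \<rightarrow>\<^sub>E UNIV"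
    then show "restrict (restrict (v \<circ> g) A \<circ> inv_into A g) B = v"
      using assms bij_betw_inv_into[OF assms]
      by (intro PiE_ext[of _ B "\<lambda>_. UNIV"])
        (auto simp: bij_betw_inv_into_right bij_betw_apply)
  qed
  show "\<forall>x\<in>A \<rightarrow>\<^sub>E (UNIV :: 'c set). restrict (restrict (x \<circ> inv_into A g) B \<circ> g) A = x"
  proof
    fix x :: "'a \<Rightarrow> 'c" assume "x \<in> A \<rightarrow>\<^sub>E UNIV"
    then show "restrict (restrict (x \<circ> inv_into A g) B \<circ> g) A = x"
      using assms
      by (intro PiE_ext[of _ A "\<lambda>_. UNIV"])
        (auto simp: bij_betw_inv_into_left bij_betw_apply)
  qed
qed auto

text \<open>Serves to cut the renumbering of all functions down to the points of the
  variety.\<close>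

lemma bij_betw_preimage:
  assumes "bij_betw f A B" and "C \<subseteq> B"
  shows "bij_betw f {x \<in> A. f x \<in> C} C"
  using assms by (auto simp: bij_betw_def inj_on_def)

theorem theorem6p7:
  fixes n k :: nat
    and lam mu nu :: "2 list"
    and \<Omega> :: "2 piece set"
    and \<Omega>' :: "3 piece set"
    and Fu Fd :: "f3_poly set"
    and fu fd :: f3_poly
    and idx :: "edge \<Rightarrow> nat"
  assumes "0 < k" and "k \<le> n"
    and "length lam = n" and "length mu = n" and "length nu = n"
    and "count_list lam 1 = k" and "count_list mu 1 = k" and "count_list nu 1 = k"
    and "\<forall>p\<in>\<Omega>. is_piece p"
    and "atomic_refinement \<Omega> \<Omega>'"
    and "upward_distinguishing \<Omega>' Fu" and "fu \<in> Fu"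
    and "downward_distinguishing \<Omega>' Fd" and "fd \<in> Fd"
    and "bij_betw idx (triangle_edges n) {1..num_edges n}"
  shows "\<exists>\<phi>. bij_betw \<phi>
    (variety (num_edges n) (atomic_puzzle_ideal n lam mu nu idx fu fd))
    (tilings \<Omega>' (map_piece f2_to_f3 (puzzle_triangle n lam mu nu)))"
proof -
  let ?p = "map_piece f2_to_f3 (puzzle_triangle n lam mu nu)"
  let ?E = "triangle_edges n"
  let ?V = "variety (num_edges n) (atomic_puzzle_ideal n lam mu nu idx fu fd)"
  have \<Omega>': "\<Omega>' \<subseteq> atomic_pieces"
    using assms(10) by (rule atomic_refinement_subset)
  have V: "?V = {v \<in> {1..num_edges n} \<rightarrow>\<^sub>E UNIV. restrict (v \<circ> idx) ?E \<in> labellings \<Omega>' ?p}"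
    using assms(3-5) \<Omega>' assms(11-15)
    by (intro variety_atomic_puzzle_ideal) (auto simp: bij_betw_def)
  have E: "cell_edges (cells ?p) = ?E"
    by (simp add: cells_map_piece puzzle_triangle_def cell_edges_def triangle_edges_def)
  have L: "labellings \<Omega>' ?p \<subseteq> ?E \<rightarrow>\<^sub>E UNIV"
    unfolding labellings_def E by blast
  have bij: "bij_betw (\<lambda>v. restrict (v \<circ> idx) ?E) ({1..num_edges n} \<rightarrow>\<^sub>E UNIV) (?E \<rightarrow>\<^sub>E (UNIV :: 3 set))"
    using assms(15) by (rule bij_betw_restrict_comp)
  \<comment> \<open>By \<open>V\<close>, the variety is exactly the preimage of the labellings under
    the renumbering.\<close>
  have "bij_betw (\<lambda>v. restrict (v \<circ> idx) ?E) ?V (labellings \<Omega>' ?p)"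
    unfolding V using bij L by (rule bij_betw_preimage)
  moreover have "dom (val ?p) \<subseteq> cell_edges (cells ?p)"
    unfolding E using boundary_edges_subset[of n]
    by (simp add: val_map_piece dom_map_option_comp val_puzzle_triangle(4)[OF assms(3-5)])
  then have "bij_betw (\<lambda>x. labelled_cell x ` cells ?p) (labellings \<Omega>' ?p) (tilings \<Omega>' ?p)"
    using \<Omega>' unfolding atomic_pieces_def by (intro bij_betw_labellings_tilings) blast+
  ultimately show ?thesis
    using bij_betw_trans by blast
qed

end
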